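(* Let $Q$ be a spider web quiver with any number of concentric circles, and choose two adjacent circles $C$ and $D$. Let $\tau_C$ denote the mutation sequence $\mu_1\mu_2\cdots\mu_{n-2}s_{n-1,n}\mu_n\cdots\mu_1$ performed on the vertices $1,\dots,n$ of $C$ (labeled following the arrows), and $\tau_D$ the analogous sequence on $D$. Then applying $\tau_C$, then $\tau_D$, then $\tau_C$ yields the same $x$-variables as applying $\tau_D$, then $\tau_C$, then $\tau_D$.
   Context: Quiver: directed graph without loops or 2-cycles. Seed mutation $\mu_k$: mutate the quiver at $k$ (add $i\to j$ for each path $i\to k\to j$, reverse arrows at $k$, cancel 2-cycles) and replace $x_k$ by $\big(\prod_j x_j^{\#\{k\to j\}}+\prod_j x_j^{\#\{j\to k\}}\big)/x_k$, other variables unchanged. $s_{n-1,n}$ transposes vertices $n-1$ and $n$; sequences are applied rightmost first. A spider web quiver: three or more concentric circles, at least 2 vertices on each, circle edges oriented counterclockwise, plus arrows between adjacent circles so every face is a directed cycle with exactly two arrows between circles and at least 3 sides. When applying the sequence to a circle, that circle plays the role of the middle circle and its neighboring circles play the roles of outer and inner circles. *)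

theory Defs
  imports
    Complex_Main
    "HOL-Library.Poly_Mapping"
    "HOL-Library.Nat_Bijection"
    "HOL-Computational_Algebra.Fraction_Field"
    "HOL-Combinatorics.Transposition"
begin

section \<open>Quivers, seeds and mutation\<close>

text \<open>\<open>q i j\<close> is the number of arrows from \<open>i\<close> to \<open>j\<close>.\<close>

type_synonym 'v quiver = "'v \<Rightarrow> 'v \<Rightarrow> nat"

text \<open>Removal of a maximal set of disjoint 2-cycles; the subtraction is the truncated one.\<close>

definition cancel_2cycles :: "'v quiver \<Rightarrow> 'v quiver" where
  "cancel_2cycles q = (\<lambda>i j. q i j - q j i)"

definition mutate_quiver :: "'v \<Rightarrow> 'v quiver \<Rightarrow> 'v quiver" where
  "mutate_quiver k q =
     cancel_2cycles (\<lambda>i j. if i = k \<or> j = k then q j i else q i j + q i k * q k j)"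

definition mutate_vars :: "'v set \<Rightarrow> 'v \<Rightarrow> 'v quiver \<Rightarrow> ('v \<Rightarrow> 'a::field) \<Rightarrow> 'v \<Rightarrow> 'a" where
  "mutate_vars V k q x =
     x(k := ((\<Prod>j\<in>V. x j ^ q k j) + (\<Prod>j\<in>V. x j ^ q j k)) / x k)"

text \<open>A seed on a fixed finite vertex set \<open>V\<close>: a quiver and the \<open>x\<close>-variables at its vertices.
  Values outside \<open>V\<close> carry no meaning.\<close>

type_synonym ('v, 'a) seed = "'v quiver \<times> ('v \<Rightarrow> 'a)"

definition mutate :: "'v set \<Rightarrow> 'v \<Rightarrow> ('v, 'a::field) seed \<Rightarrow> ('v, 'a) seed" where
  "mutate V k s = (mutate_quiver k (fst s), mutate_vars V k (fst s) (snd s))"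

definition swap_vertices :: "'v \<Rightarrow> 'v \<Rightarrow> ('v, 'a) seed \<Rightarrow> ('v, 'a) seed" where
  "swap_vertices u v s =
     (\<lambda>i j. fst s (transpose u v i) (transpose u v j), \<lambda>i. snd s (transpose u v i))"

text \<open>For \<open>vs = [v\<^sub>1, \<dots>, v\<^sub>n]\<close> with \<open>n \<ge> 2\<close>, the sequence
  \<open>\<mu>\<^sub>1 \<mu>\<^sub>2 \<dots> \<mu>\<^sub>n\<^sub>-\<^sub>2 s\<^sub>n\<^sub>-\<^sub>1\<^sub>,\<^sub>n \<mu>\<^sub>n \<dots> \<mu>\<^sub>1\<close>, rightmost first. Note that
  \<open>fold f [a, b]\<close> applies \<open>f a\<close> before \<open>f b\<close>.\<close>

definition tau :: "'v set \<Rightarrow> 'v list \<Rightarrow> ('v, 'a::field) seed \<Rightarrow> ('v, 'a) seed" where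
  "tau V vs =
     fold (mutate V) (rev (take (length vs - 2) vs))
     \<circ> swap_vertices (vs ! (length vs - 2)) (vs ! (length vs - 1))
     \<circ> fold (mutate V) vs"


section \<open>Spider web quivers\<close>

text \<open>Circles are numbered from the outside in; circle \<open>c\<close> carries the vertices \<open>(c, i)\<close> with
  \<open>i < circle_size W c\<close>, in counterclockwise order.

  The annulus between the circles \<open>c\<close> and \<open>c + 1\<close> is described after cutting it open and
  unrolling it counterclockwise, starting at one of the arrows drawn in it. Its arrows are numbered
  \<open>0, \<dots>, M - 1\<close> in this order, where \<open>M = num_arrows W c\<close>, and index \<open>M\<close> stands for arrow \<open>0\<close>
  seen again after one full turn. Arrow \<open>k\<close> joins the vertex at (unrolled) position
  \<open>outer_end W c k\<close> on circle \<open>c\<close> to the vertex at position \<open>inner_end W c k\<close> on circle \<open>c + 1\<close>;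
  \<open>inward W c k\<close> says whether it points from circle \<open>c\<close> to circle \<open>c + 1\<close>.\<close>

type_synonym vertex = "nat \<times> nat"

record web =
  num_circles :: nat
  circle_size :: "nat \<Rightarrow> nat"
  num_arrows :: "nat \<Rightarrow> nat"
  outer_end :: "nat \<Rightarrow> nat \<Rightarrow> nat"
  inner_end :: "nat \<Rightarrow> nat \<Rightarrow> nat"
  inward :: "nat \<Rightarrow> nat \<Rightarrow> bool"

definition position :: "web \<Rightarrow> nat \<Rightarrow> nat \<Rightarrow> vertex" where
  "position W c p = (c, p mod circle_size W c)"

text \<open>The arrows of annulus \<open>c\<close> do not cross, and they close up after one full turn.\<close>

definition planar_annulus :: "web \<Rightarrow> nat \<Rightarrow> bool" where
  "planar_annulus W c \<longleftrightarrow>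
     (\<forall>k < num_arrows W c. outer_end W c k \<le> outer_end W c (Suc k) \<and>
                           inner_end W c k \<le> inner_end W c (Suc k)) \<and>
     outer_end W c (num_arrows W c) = outer_end W c 0 + circle_size W c \<and>
     inner_end W c (num_arrows W c) = inner_end W c 0 + circle_size W (Suc c) \<and>
     inward W c (num_arrows W c) = inward W c 0"

text \<open>Face \<open>k\<close> of annulus \<open>c\<close> lies between the arrows \<open>k\<close> and \<open>k + 1\<close>, so exactly two arrows
  between circles occur on its boundary. Walk around the boundary counterclockwise along the outer
  circle, along arrow \<open>k + 1\<close> to the inner circle, clockwise along the inner circle, and back along
  arrow \<open>k\<close>. The list below has one entry per side, telling whether the side is traversed along its
  orientation; all circle edges are oriented counterclockwise.\<close>

definition face_sides :: "web \<Rightarrow> nat \<Rightarrow> nat \<Rightarrow> bool list" where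
  "face_sides W c k =
     replicate (outer_end W c (Suc k) - outer_end W c k) True
     @ [inward W c (Suc k)]
     @ replicate (inner_end W c (Suc k) - inner_end W c k) False
     @ [\<not> inward W c k]"

definition face_vertices :: "web \<Rightarrow> nat \<Rightarrow> nat \<Rightarrow> vertex list" where
  "face_vertices W c k =
     map (position W c) [outer_end W c k ..< Suc (outer_end W c (Suc k))]
     @ map (position W (Suc c)) (rev [inner_end W c k ..< Suc (inner_end W c (Suc k))])"

text \<open>A directed cycle visits each of its vertices only once. In particular a face whose outer or
  inner arc is a whole circle is not a directed cycle (its two arrows would form a 2-cycle).\<close>

definition directed_cycle_face :: "web \<Rightarrow> nat \<Rightarrow> nat \<Rightarrow> bool" where
  "directed_cycle_face W c k \<longleftrightarrow>
     ((\<forall>b \<in> set (face_sides W c k). b) \<or> (\<forall>b \<in> set (face_sides W c k). \<not> b)) \<and>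
     distinct (face_vertices W c k)"

definition spider_web :: "web \<Rightarrow> bool" where
  "spider_web W \<longleftrightarrow>
     3 \<le> num_circles W \<and>
     (\<forall>c < num_circles W. 2 \<le> circle_size W c) \<and>
     (\<forall>c. Suc c < num_circles W \<longrightarrow>
        planar_annulus W c \<and>
        (\<forall>k < num_arrows W c.
           directed_cycle_face W c k \<and> 3 \<le> length (face_sides W c k)))"

definition web_vertices :: "web \<Rightarrow> vertex set" where
  "web_vertices W = (SIGMA c:{..<num_circles W}. {..<circle_size W c})"

definition circle_arrow :: "web \<Rightarrow> vertex \<Rightarrow> vertex \<Rightarrow> bool" where
  "circle_arrow W u v \<longleftrightarrow> u \<in> web_vertices W \<and> v = position W (fst u) (Suc (snd u))"

text \<open>Source and target of arrow \<open>k\<close> of annulus \<open>c\<close>.\<close>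

definition radial_arrow :: "web \<Rightarrow> nat \<Rightarrow> nat \<Rightarrow> vertex \<times> vertex" where
  "radial_arrow W c k =
     (let u = position W c (outer_end W c k); w = position W (Suc c) (inner_end W c k)
      in if inward W c k then (u, w) else (w, u))"

text \<open>On a circle with exactly two vertices the two circle edges form a 2-cycle. These edges bound
  faces like all others, but the quiver, having no 2-cycles, does not contain them: hence the
  cancellation.\<close>

definition web_quiver :: "web \<Rightarrow> vertex quiver" where
  "web_quiver W = cancel_2cycles (\<lambda>u v.
     of_bool (circle_arrow W u v) +
     card {(c, k). Suc c < num_circles W \<and> k < num_arrows W c \<and> radial_arrow W c k = (u, v)})"

text \<open>The vertices of circle \<open>c\<close> listed along the circle edges, from an arbitrary starting vertex.\<close>

definition circle_labelling :: "web \<Rightarrow> nat \<Rightarrow> nat \<Rightarrow> vertex list" where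
  "circle_labelling W c a = rotate a (map (\<lambda>i. (c, i)) [0..<circle_size W c])"


section \<open>Initial seed\<close>

text \<open>The field of rational functions over \<open>\<rat>\<close> in indeterminates \<open>t\<^sub>0, t\<^sub>1, \<dots>\<close>, as the fraction
  field of the ring of polynomials (finitely supported maps from exponent vectors to coefficients).
  The initial variable at vertex \<open>v\<close> is the indeterminate numbered \<open>prod_encode v\<close>; the encoding
  avoids a linear order on pairs, which the integral domain instance for polynomials would need.\<close>

type_synonym ratfun = "((nat \<Rightarrow>\<^sub>0 nat) \<Rightarrow>\<^sub>0 rat) fract"

definition indeterminate :: "nat \<Rightarrow> ratfun" where
  "indeterminate m = Fract (Poly_Mapping.single (Poly_Mapping.single m 1) 1) 1"

definition initial_seed :: "web \<Rightarrow> (vertex, ratfun) seed" where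
  "initial_seed W = (web_quiver W, \<lambda>v. indeterminate (prod_encode v))"

end

theory Submission
  imports Defs
begin

text \<open>For an edge \<open>c \<rightarrow> s c\<close> of a circle \<open>S\<close>, let \<open>N c\<close> be the product of the variables of the
  vertices outside \<open>S\<close> whose two arrows with \<open>S\<close> close up a path through that edge to a directed
  cycle. The potential of \<open>S\<close> is \<open>P\<^sub>S = (\<Sum>c\<in>S. N c / (x c * x (s c)))\<close>. Mutation at a vertex \<open>v\<close>
  of \<open>S\<close> turns \<open>S\<close> into an oriented cycle through \<open>S - {v}\<close> with the same potential, and
  \<open>\<tau>\<^sub>S\<close> is the sequence for \<open>S - {v}\<close> conjugated by this mutation. By induction down to two
  vertices, \<open>\<tau>\<^sub>S\<close> restores the quiver and multiplies the variables on \<open>S\<close> by \<open>P\<^sub>S\<close>.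

  Each edge of the circle \<open>D\<close> lies in one face with apex on the adjacent circle \<open>C\<close>, so \<open>\<tau>\<^sub>C\<close>
  replaces \<open>(P\<^sub>C, P\<^sub>D)\<close> by \<open>(1 / P\<^sub>C, P\<^sub>C * P\<^sub>D)\<close>, and symmetrically. Both sides of the braid
  relation therefore multiply all variables on \<open>C\<close> and \<open>D\<close> by \<open>P\<^sub>C * P\<^sub>D\<close>. No division
  by zero occurs because all expressions are subtraction-free.\<close>

section \<open>Mutation of quivers\<close>

definition two_acyclic :: "'v quiver \<Rightarrow> bool" where
  "two_acyclic q \<longleftrightarrow> (\<forall>i j. q i j = 0 \<or> q j i = 0)"

lemma two_acyclicD: "two_acyclic q \<Longrightarrow> q i j = 0 \<or> q j i = 0"
  by (simp add: two_acyclic_def)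

lemma two_acyclic_loop: "two_acyclic q \<Longrightarrow> q i i = 0"
  using two_acyclicD by fastforce

lemma two_acyclic_cancel_2cycles: "two_acyclic (cancel_2cycles q)"
  by (auto simp: two_acyclic_def cancel_2cycles_def)

lemma two_acyclic_mutate_quiver: "two_acyclic (mutate_quiver k q)"
  by (simp add: mutate_quiver_def two_acyclic_cancel_2cycles)

lemma mutate_quiver_at:
  assumes "two_acyclic q" and "i = k \<or> j = k"
  shows "mutate_quiver k q i j = q j i"
  using assms two_acyclicD[OF assms(1), of i j]
  by (auto simp: mutate_quiver_def cancel_2cycles_def)

lemma mutate_quiver_off:
  assumes "i \<noteq> k" and "j \<noteq> k"
  shows "mutate_quiver k q i j = (q i j + q i k * q k j) - (q j i + q j k * q k i)"
  using assms by (simp add: mutate_quiver_def cancel_2cycles_def)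

text \<open>The arithmetic of mutating twice at \<open>k\<close>: \<open>a\<close> and
  \<open>b\<close> stand for the arrows between \<open>i\<close> and \<open>j\<close>,
  \<open>m\<close> and \<open>n\<close> for the paths through \<open>k\<close> in the two
  directions. Reversing the arrows at \<open>k\<close> exchanges \<open>m\<close> and
  \<open>n\<close>, so the second mutation undoes the first.\<close>

lemma truncated_diff_twice:
  fixes a b m n :: nat
  assumes "a = 0 \<or> b = 0"
  shows "((a + m) - (b + n)) + n - (((b + n) - (a + m)) + m) = a"
  using assms by auto

lemma mutate_quiver_involution:
  assumes "two_acyclic q"
  shows "mutate_quiver k (mutate_quiver k q) = q"
proof (intro ext)
  fix i j
  show "mutate_quiver k (mutate_quiver k q) i j = q i j"
  proof (cases "i = k \<or> j = k")
    case True
    then show ?thesis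
      using assms by (auto simp: mutate_quiver_at two_acyclic_mutate_quiver)
  next
    case False
    then show ?thesis
      using assms truncated_diff_twice[OF two_acyclicD[OF assms, of i j]]
      by (simp add: mutate_quiver_at mutate_quiver_off[of i k j "mutate_quiver k q"]
          mutate_quiver_off[of i k j q] mutate_quiver_off[of j k i q] mult.commute)
  qed
qed

section \<open>Cyclic orders\<close>

text \<open>The closure clause makes \<open>S\<close> a single orbit of \<open>s\<close>. This form
  survives the deletion of a vertex without any numbering of the cycle.\<close>

definition cyclic_order :: "'v set \<Rightarrow> ('v \<Rightarrow> 'v) \<Rightarrow> ('v \<Rightarrow> 'v) \<Rightarrow> bool" where
  "cyclic_order S s p \<longleftrightarrow>
     (\<forall>c\<in>S. s c \<in> S \<and> p c \<in> S \<and> p (s c) = c \<and> s (p c) = c) \<and>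
     (\<forall>T\<subseteq>S. T \<noteq> {} \<longrightarrow> s ` T \<subseteq> T \<longrightarrow> T = S)"

lemma cyclic_orderD:
  assumes "cyclic_order S s p" and "c \<in> S"
  shows "s c \<in> S" "p c \<in> S" "p (s c) = c" "s (p c) = c"
  using assms by (auto simp: cyclic_order_def)

lemma cyclic_order_closed:
  assumes "cyclic_order S s p" and "T \<subseteq> S" and "T \<noteq> {}" and "\<And>c. c \<in> T \<Longrightarrow> s c \<in> T"
  shows "T = S"
  using assms unfolding cyclic_order_def by (meson image_subsetI)

lemma cyclic_order_succ_neq:
  assumes "cyclic_order S s p" and "c \<in> S" and "2 \<le> card S"
  shows "s c \<noteq> c"
proof
  assume "s c = c"
  then have "{c} = S"
    using assms cyclic_order_closed[of S s p "{c}"] by auto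
  with assms(3) show False
    by auto
qed

lemma cyclic_order_succ2_neq:
  assumes "cyclic_order S s p" and "c \<in> S" and "3 \<le> card S"
  shows "s (s c) \<noteq> c"
proof
  assume "s (s c) = c"
  then have "{c, s c} = S"
    using assms cyclic_orderD[OF assms(1,2)] cyclic_order_closed[of S s p "{c, s c}"] by auto
  moreover have "card {c, s c} \<le> 2"
    by (simp add: card_insert_if)
  ultimately show False
    using assms(3) by auto
qed

lemma cyclic_order_remove:
  assumes cyc: "cyclic_order S s p" and v: "v \<in> S" and card: "2 \<le> card S"
  shows "cyclic_order (S - {v}) (s(p v := s v)) (p(s v := p v))"
proof -
  let ?s = "s(p v := s v)" and ?p = "p(s v := p v)"
  note D = cyclic_orderD[OF cyc]
  have neq: "s v \<noteq> v" "p v \<noteq> v"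
    using cyclic_order_succ_neq[OF cyc v card] D(4)[OF v] by auto
  have "?s c \<in> S - {v} \<and> ?p c \<in> S - {v} \<and> ?p (?s c) = c \<and> ?s (?p c) = c"
    if c: "c \<in> S - {v}" for c
    using c D[of c] D[OF v] neq by (auto simp: fun_upd_def split: if_splits)
  \<comment> \<open>If \<open>T\<close> contains \<open>p v\<close>, inserting \<open>v\<close>
    makes it closed under \<open>s\<close>. Otherwise both successor maps agree on \<open>T\<close>,
    so \<open>T\<close> would be all of \<open>S\<close> and contain \<open>v\<close>.\<close>
  moreover have "T = S - {v}" if T: "T \<subseteq> S - {v}" "T \<noteq> {}" "?s ` T \<subseteq> T" for T
  proof (cases "p v \<in> T")
    case True
    have "insert v T = S"
    proof (rule cyclic_order_closed[OF cyc])
      have "s v \<in> T"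
        using T(3) True by force
      moreover have "s c \<in> insert v T" if "c \<in> T" for c
        using that T(3) D(4)[OF v] by (cases "c = p v") force+
      ultimately show "s c \<in> insert v T" if "c \<in> insert v T" for c
        using that by blast
    qed (use T v in auto)
    then show ?thesis
      using T(1) by auto
  next
    case False
    have "T = S"
      using T False by (intro cyclic_order_closed[OF cyc]) force+
    then show ?thesis
      using T(1) v by auto
  qed
  ultimately show ?thesis
    unfolding cyclic_order_def by blast
qed

section \<open>Oriented cycles in a quiver\<close>

text \<open>\<open>e w c\<close> counts how often the edge leaving \<open>c\<close> lies on a path of \<open>S\<close> that is closed up to
  a cycle by an arrow into the outside vertex \<open>w\<close> and an arrow out of it. The truncated
  differences encode the cancellation of 2-cycles. That \<open>w\<close> misses some edge makes the two
  monomials of the exchange relation coprime to each other once \<open>S\<close> has only two vertices.\<close>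

definition cycle_in_quiver ::
    "'v quiver \<Rightarrow> 'v set \<Rightarrow> ('v \<Rightarrow> 'v) \<Rightarrow> ('v \<Rightarrow> 'v) \<Rightarrow> ('v \<Rightarrow> 'v \<Rightarrow> nat) \<Rightarrow> bool" where
  "cycle_in_quiver q S s p e \<longleftrightarrow>
     two_acyclic q \<and> cyclic_order S s p \<and>
     (\<forall>c\<in>S. \<forall>d\<in>S. q c d = of_bool (d = s c) - of_bool (c = s d)) \<and>
     (\<forall>c\<in>S. \<forall>w. w \<notin> S \<longrightarrow> q c w = e w (p c) - e w c \<and> q w c = e w c - e w (p c)) \<and>
     (\<forall>w. w \<notin> S \<longrightarrow> (\<exists>c\<in>S. e w c = 0))"

definition potential ::
    "'v set \<Rightarrow> 'v set \<Rightarrow> ('v \<Rightarrow> 'v) \<Rightarrow> ('v \<Rightarrow> 'v \<Rightarrow> nat) \<Rightarrow> ('v \<Rightarrow> 'a::field) \<Rightarrow> 'a" where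
  "potential V S s e x = (\<Sum>c\<in>S. (\<Prod>w\<in>V - S. x w ^ e w c) / (x c * x (s c)))"

text \<open>Cover after mutation at \<open>v\<close>. The new edge from \<open>p v\<close> to
  \<open>s v\<close> and the reversed arrows at \<open>v\<close> form a triangle, so
  \<open>v\<close> covers exactly that edge. For any other \<open>w\<close>, the arrows composed
  through \<open>v\<close> leave the minimum of its covers of the two merged edges.\<close>

definition reduced_cover ::
    "('v \<Rightarrow> 'v) \<Rightarrow> 'v \<Rightarrow> ('v \<Rightarrow> 'v \<Rightarrow> nat) \<Rightarrow> 'v \<Rightarrow> 'v \<Rightarrow> nat" where
  "reduced_cover p v e w c =
     (if w = v then of_bool (c = p v) else if c = p v then min (e w v) (e w (p v)) else e w c)"

lemma cycle_in_quiverD: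
  assumes "cycle_in_quiver q S s p e"
  shows "two_acyclic q" "cyclic_order S s p"
    and "\<And>c d. c \<in> S \<Longrightarrow> d \<in> S \<Longrightarrow> q c d = of_bool (d = s c) - of_bool (c = s d)"
    and "\<And>c w. c \<in> S \<Longrightarrow> w \<notin> S \<Longrightarrow> q c w = e w (p c) - e w c"
    and "\<And>c w. c \<in> S \<Longrightarrow> w \<notin> S \<Longrightarrow> q w c = e w c - e w (p c)"
    and "\<And>w. w \<notin> S \<Longrightarrow> \<exists>c\<in>S. e w c = 0"
  using assms by (auto simp: cycle_in_quiver_def)

text \<open>Inside \<open>S\<close> the vertex \<open>v\<close> has only the arrows from
  \<open>p v\<close> and to \<open>s v\<close>, so mutation adds the single arrow that closes the
  shortened cycle. At least three vertices are required so that \<open>p v\<close> and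
  \<open>s v\<close> differ.\<close>

lemma cycle_in_quiver_mutate:
  assumes cyc: "cycle_in_quiver q S s p e" and v: "v \<in> S" and card: "3 \<le> card S"
  shows "cycle_in_quiver (mutate_quiver v q) (S - {v}) (s(p v := s v)) (p(s v := p v))
    (reduced_cover p v e)"
proof -
  let ?s = "s(p v := s v)" and ?p = "p(s v := p v)" and ?e = "reduced_cover p v e"
  note D = cycle_in_quiverD[OF cyc]
  note cD = cyclic_orderD[OF D(2)]
  have card2: "2 \<le> card S"
    using card by simp
  have ne1: "\<And>c. c \<in> S \<Longrightarrow> s c \<noteq> c" and ne2: "\<And>c. c \<in> S \<Longrightarrow> s (s c) \<noteq> c"
    using cyclic_order_succ_neq[OF D(2) _ card2] cyclic_order_succ2_neq[OF D(2) _ card] by auto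
  have s_eq: "s c = v \<longleftrightarrow> c = p v" if "c \<in> S" for c
    using that cD v by metis
  have s_inj: "s c = s d \<longleftrightarrow> c = d" if "c \<in> S" "d \<in> S" for c d
    using that cD by metis
  have pv: "p v \<in> S" "p v \<noteq> v" "s (p v) = v" and sv: "s v \<in> S" "s v \<noteq> v" "p (s v) = v"
    and psv: "p v \<noteq> s v"
    using cD[OF v] ne1[OF v] ne2[OF v] by metis+
  have q_into: "q c v = of_bool (c = p v)" and q_from: "q v c = of_bool (c = s v)"
    if "c \<in> S" for c
    using that D(3)[OF that v] D(3)[OF v that] s_eq psv pv(3) ne2[OF v] by auto
  \<comment> \<open>If only two vertices remain, the new arrow cancels against the old arrow from
    \<open>s v\<close> to \<open>p v\<close>, in accordance with the truncated difference.\<close>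
  have inner: "mutate_quiver v q c d = of_bool (d = ?s c) - of_bool (c = ?s d)"
    if "c \<in> S - {v}" "d \<in> S - {v}" for c d
  proof -
    have cd: "c \<in> S" "c \<noteq> v" "d \<in> S" "d \<noteq> v"
      using that by auto
    show ?thesis
      unfolding mutate_quiver_off[OF cd(2,4)] q_into[OF cd(1)] q_into[OF cd(3)]
        q_from[OF cd(1)] q_from[OF cd(3)] D(3)[OF cd(1,3)] D(3)[OF cd(3,1)]
      using psv pv sv cd ne2[OF cd(1)] ne2[OF cd(3)] ne1[OF cd(1)] ne1[OF cd(3)]
      by auto
  qed
  have outer: "mutate_quiver v q c w = ?e w (?p c) - ?e w c \<and>
      mutate_quiver v q w c = ?e w c - ?e w (?p c)"
    if "c \<in> S - {v}" "w \<notin> S - {v}" for c w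
  proof -
    have c: "c \<in> S" "c \<noteq> v"
      using that by auto
    have pc: "p c = p v \<longleftrightarrow> c = v" "p c = v \<longleftrightarrow> c = s v"
      using cD[OF c(1)] cD[OF v] by metis+
    show ?thesis
    proof (cases "w = v")
      case True
      then show ?thesis
        using psv pc c mutate_quiver_at[OF D(1), of c v v] mutate_quiver_at[OF D(1), of v v c]
        by (auto simp: q_into q_from reduced_cover_def)
    next
      case False
      with that have w: "w \<notin> S"
        by auto
      show ?thesis
        unfolding mutate_quiver_off[OF c(2) False] mutate_quiver_off[OF False c(2)]
          q_into[OF c(1)] q_from[OF c(1)] D(4)[OF c(1) w] D(5)[OF c(1) w]
          D(4)[OF v w] D(5)[OF v w] reduced_cover_def
        using psv pv sv pc c False by auto
    qed
  qed
  \<comment> \<open>The vertex \<open>v\<close> misses the edge at \<open>s v\<close>. Another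
    \<open>w\<close> keeps its uncovered edge, except that one at \<open>v\<close> is passed on to
    \<open>p v\<close> by the minimum.\<close>
  have uncovered: "\<exists>c\<in>S - {v}. ?e w c = 0" if "w \<notin> S - {v}" for w
  proof (cases "w = v")
    case True
    then show ?thesis
      using sv psv by (intro bexI[of _ "s v"]) (auto simp: reduced_cover_def)
  next
    case False
    with that obtain c where c: "c \<in> S" "e w c = 0"
      using D(6) by blast
    show ?thesis
    proof (cases "c = v")
      case True
      then show ?thesis
        using False c pv by (intro bexI[of _ "p v"]) (auto simp: reduced_cover_def)
    next
      case cv: False
      then show ?thesis
        using False c by (intro bexI[of _ c]) (auto simp: reduced_cover_def)
    qed
  qed
  show ?thesis
    unfolding cycle_in_quiver_def
    using two_acyclic_mutate_quiver[of v q] cyclic_order_remove[OF D(2) v card2]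
      inner outer uncovered by blast
qed

text \<open>The two exchange monomials at \<open>v\<close>. Each contains exactly one variable of
  the cycle, to the first power, because \<open>p v\<close> and \<open>s v\<close> are
  distinct.\<close>

lemma prod_quiver_cycle:
  assumes cyc: "cycle_in_quiver q S s p e" and v: "v \<in> S" and card: "3 \<le> card S"
    and V: "finite V" "S \<subseteq> V"
  shows "(\<Prod>j\<in>V. x j ^ q v j) = x (s v) * (\<Prod>w\<in>V - S. x w ^ (e w (p v) - e w v))"
    and "(\<Prod>j\<in>V. x j ^ q j v) = x (p v) * (\<Prod>w\<in>V - S. x w ^ (e w v - e w (p v)))"
proof -
  note D = cycle_in_quiverD[OF cyc]
  note cD = cyclic_orderD[OF D(2)]
  have S: "finite S"
    using V finite_subset by blast
  have ne: "s (s v) \<noteq> v"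
    using cyclic_order_succ2_neq[OF D(2) v card] .
  have split: "(\<Prod>j\<in>V. f j) = (\<Prod>j\<in>S. f j) * (\<Prod>j\<in>V - S. f j)" for f :: "_ \<Rightarrow> 'b"
    using prod.subset_diff[OF V(2,1)] by (simp add: mult.commute)
  have q: "q v j = of_bool (j = s v)" "q j v = of_bool (j = p v)" if "j \<in> S" for j
    using D(3)[OF v that] D(3)[OF that v] cD[OF v] cD[OF that] ne by (auto split: if_splits)
  have "(\<Prod>j\<in>S. x j ^ q v j) = (\<Prod>j\<in>S. if j = s v then x j else 1)"
    by (intro prod.cong) (auto simp: q)
  then show "(\<Prod>j\<in>V. x j ^ q v j) = x (s v) * (\<Prod>w\<in>V - S. x w ^ (e w (p v) - e w v))"
    using S cD(1)[OF v] D(4)[OF v] by (simp add: split)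
  have "(\<Prod>j\<in>S. x j ^ q j v) = (\<Prod>j\<in>S. if j = p v then x j else 1)"
    by (intro prod.cong) (auto simp: q)
  then show "(\<Prod>j\<in>V. x j ^ q j v) = x (p v) * (\<Prod>w\<in>V - S. x w ^ (e w v - e w (p v)))"
    using S cD(2)[OF v] D(5)[OF v] by (simp add: split)
qed

text \<open>The exchange relation at \<open>v\<close> merges the two summands of
  the edges at \<open>v\<close> into the summand of the new edge from \<open>p v\<close> to \<open>s v\<close>.\<close>

lemma potential_mutate:
  fixes x :: "'v \<Rightarrow> 'a::field"
  assumes cyc: "cycle_in_quiver q S s p e" and v: "v \<in> S" and card: "3 \<le> card S"
    and V: "finite V" "S \<subseteq> V" and x: "\<And>c. c \<in> S \<Longrightarrow> x c \<noteq> 0"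
  shows "potential V (S - {v}) (s(p v := s v)) (reduced_cover p v e) (mutate_vars V v q x) =
    potential V S s e x"
proof -
  let ?e = "reduced_cover p v e" and ?s = "s(p v := s v)"
  define y where "y = mutate_vars V v q x"
  define mono where "mono f = (\<Prod>w\<in>V - S. x w ^ f w)" for f :: "'v \<Rightarrow> nat"
  have mono_mult: "mono f * mono g = mono (\<lambda>w. f w + g w)" for f g
    by (simp add: mono_def power_add prod.distrib)
  note D = cycle_in_quiverD[OF cyc]
  note cD = cyclic_orderD[OF D(2)]
  have S: "finite S"
    using V finite_subset by blast
  have pv: "p v \<in> S" "p v \<noteq> v" "s (p v) = v" and sv: "s v \<in> S" "s v \<noteq> v"
    using cD[OF v] cyclic_order_succ_neq[OF D(2) v] card by auto
  have yv: "y v = (x (s v) * mono (\<lambda>w. e w (p v) - e w v) +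
      x (p v) * mono (\<lambda>w. e w v - e w (p v))) / x v"
    unfolding y_def mutate_vars_def mono_def
    by (simp add: prod_quiver_cycle[OF cyc v card V])
  have y: "y c = x c" if "c \<noteq> v" for c
    using that by (simp add: y_def mutate_vars_def)
  have V': "V - (S - {v}) = insert v (V - S)"
    using v V by auto
  \<comment> \<open>In the new potential \<open>v\<close> counts as an outside vertex, so its new
    variable enters the numerators.\<close>
  have mono_y: "(\<Prod>w\<in>V - (S - {v}). y w ^ f w) = y v ^ f v * mono f" for f
  proof -
    have "(\<Prod>w\<in>V - S. y w ^ f w) = mono f"
      unfolding mono_def using v by (intro prod.cong refl) (metis DiffD2 y)
    then show ?thesis
      using V v by (simp add: V')
  qed
  have mono_cong: "mono (\<lambda>w. ?e w c) = mono (\<lambda>w. f w)" if "\<And>w. w \<noteq> v \<Longrightarrow> ?e w c = f w" for c f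
    unfolding mono_def using v that by (intro prod.cong refl) (metis DiffD2)
  let ?t = "\<lambda>c. (\<Prod>w\<in>V - (S - {v}). y w ^ ?e w c) / (y c * y (?s c))"
  let ?u = "\<lambda>c. mono (\<lambda>w. e w c) / (x c * x (s c))"
  have S_split: "S = insert v (insert (p v) (S - {v, p v}))"
    and S_split': "S - {v} = insert (p v) (S - {v, p v})"
    using v pv by auto
  have rest: "?t c = ?u c" if "c \<in> S - {v, p v}" for c
  proof -
    have "s c \<noteq> v"
      using that cD(3)[of c] by auto
    moreover have "mono (\<lambda>w. ?e w c) = mono (\<lambda>w. e w c)"
      using that by (intro mono_cong) (auto simp: reduced_cover_def)
    ultimately show ?thesis
      using that by (simp add: mono_y y reduced_cover_def[of p v e v])
  qed
  have "?t (p v) = ?u v + ?u (p v)"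
  proof -
    let ?m = "mono (\<lambda>w. min (e w v) (e w (p v)))"
    have "mono (\<lambda>w. ?e w (p v)) = ?m"
      using pv by (intro mono_cong) (auto simp: reduced_cover_def)
    then have "?t (p v) = y v * ?m / (x (p v) * x (s v))"
      using pv sv by (simp add: mono_y y reduced_cover_def[of p v e v])
    \<comment> \<open>The minimum supplies the common factor of the two numerators that the exchange
      relation lacks, since \<open>(a - b) + min a b = a\<close> in truncated arithmetic.\<close>
    moreover have "mono (\<lambda>w. e w (p v) - e w v) * ?m = mono (\<lambda>w. e w (p v))"
      "mono (\<lambda>w. e w v - e w (p v)) * ?m = mono (\<lambda>w. e w v)"
      unfolding mono_mult by (auto intro!: arg_cong[of _ _ mono])
    then have "x v * (y v * ?m) = x (s v) * mono (\<lambda>w. e w (p v)) + x (p v) * mono (\<lambda>w. e w v)"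
      unfolding yv using x[OF v] by (simp add: field_simps)
    then have "y v * ?m = (x (s v) * mono (\<lambda>w. e w (p v)) + x (p v) * mono (\<lambda>w. e w v)) / x v"
      using x[OF v] by (simp add: field_simps)
    ultimately show ?thesis
      using x[OF v] x[OF pv(1)] x[OF sv(1)] pv(3) by (simp add: field_simps)
  qed
  then have "(\<Sum>c\<in>S - {v}. ?t c) = (\<Sum>c\<in>S. ?u c)"
    using S pv rest by (subst S_split', subst (2) S_split) (simp add: algebra_simps)
  then show ?thesis
    by (simp add: potential_def mono_def y_def)
qed

section \<open>The mutation sequence along an oriented cycle\<close>

definition scale :: "'v set \<Rightarrow> 'a::times \<Rightarrow> ('v \<Rightarrow> 'a) \<Rightarrow> 'v \<Rightarrow> 'a" where
  "scale S r x = (\<lambda>v. if v \<in> S then r * x v else x v)"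

text \<open>The last two vertices are the transposed pair. As long as \<open>v\<close> is not among
  them, it is mutated both first and last.\<close>

lemma tau_Cons:
  assumes "2 \<le> length us"
  shows "tau V (v # us) \<sigma> = mutate V v (tau V us (mutate V v \<sigma>))"
proof -
  have "length (v # us) - 2 = Suc (length us - 2)" "length us - 1 = Suc (length us - 2)"
    "(v # us) ! length us = us ! (length us - 1)"
    using assms by (auto simp: nth_Cons')
  then show ?thesis
    by (simp add: tau_def)
qed

text \<open>Nonvanishing alone is not preserved by sums. Membership in such a set is, and it
  justifies every denominator that occurs along the mutation sequences.\<close>

locale positive_cone =
  fixes Pos :: "'a::field set"
  assumes one_Pos: "1 \<in> Pos"
    and zero_notin_Pos: "0 \<notin> Pos"
    and add_Pos: "a \<in> Pos \<Longrightarrow> b \<in> Pos \<Longrightarrow> a + b \<in> Pos"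
    and mult_Pos: "a \<in> Pos \<Longrightarrow> b \<in> Pos \<Longrightarrow> a * b \<in> Pos"
    and inverse_Pos: "a \<in> Pos \<Longrightarrow> inverse a \<in> Pos"
begin

lemma divide_Pos: "a \<in> Pos \<Longrightarrow> b \<in> Pos \<Longrightarrow> a / b \<in> Pos"
  by (simp add: divide_inverse mult_Pos inverse_Pos)

lemma power_Pos: "a \<in> Pos \<Longrightarrow> a ^ n \<in> Pos"
  by (induction n) (auto intro: one_Pos mult_Pos)

lemma prod_Pos: "(\<And>i. i \<in> I \<Longrightarrow> f i \<in> Pos) \<Longrightarrow> prod f I \<in> Pos"
  by (induction I rule: infinite_finite_induct) (auto intro: one_Pos mult_Pos)

lemma sum_Pos: "finite I \<Longrightarrow> I \<noteq> {} \<Longrightarrow> (\<And>i. i \<in> I \<Longrightarrow> f i \<in> Pos) \<Longrightarrow> sum f I \<in> Pos"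
  by (induction I rule: finite_ne_induct) (auto intro: add_Pos)

lemma mutate_vars_Pos:
  assumes "\<And>w. w \<in> V \<Longrightarrow> x w \<in> Pos" and "v \<in> V" and "w \<in> V"
  shows "mutate_vars V v q x w \<in> Pos"
  using assms by (auto simp: mutate_vars_def intro!: divide_Pos add_Pos prod_Pos power_Pos)

lemma potential_Pos:
  assumes "\<And>w. w \<in> V \<Longrightarrow> x w \<in> Pos" and "S \<subseteq> V" and "finite S" and "S \<noteq> {}"
    and "\<And>c. c \<in> S \<Longrightarrow> s c \<in> S"
  shows "potential V S s e x \<in> Pos"
  unfolding potential_def using assms
  by (intro sum_Pos divide_Pos mult_Pos prod_Pos power_Pos) blast+

lemma scale_Pos:
  assumes "\<And>w. w \<in> V \<Longrightarrow> x w \<in> Pos" and "r \<in> Pos" and "w \<in> V"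
  shows "scale S r x w \<in> Pos"
  using assms by (simp add: scale_def mult_Pos)

text \<open>The vertices \<open>a\<close> and \<open>b\<close> are not adjacent and have opposite
  arrows to all other vertices. Both mutations therefore have the same exchange numerator, and the
  transposition undoes the reversal of the arrows.\<close>

lemma tau_two_cycle:
  assumes cyc: "cycle_in_quiver q {a, b} s p e" and ab: "a \<noteq> b"
    and V: "finite V" "{a, b} \<subseteq> V" and x: "\<And>w. w \<in> V \<Longrightarrow> x w \<in> Pos"
  shows "tau V [a, b] (q, x) = (q, scale {a, b} (potential V {a, b} s e x) x)"
proof -
  let ?S = "{a, b}"
  note D = cycle_in_quiverD[OF cyc]
  have card: "2 \<le> card ?S"
    using ab by simp
  have s: "s a = b" "s b = a" and p: "p a = b" "p b = a"
    using cyclic_orderD[OF D(2), of a] cyclic_orderD[OF D(2), of b]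
      cyclic_order_succ_neq[OF D(2) _ card] by auto
  have q_ab: "q a b = 0" "q b a = 0" and q_loop: "q a a = 0" "q b b = 0"
    using D(3)[of a b] D(3)[of b a] s ab two_acyclic_loop[OF D(1)] by auto
  \<comment> \<open>Every outside vertex misses one of the two edges, so one term of each truncated
    difference is zero.\<close>
  have q_out: "q a w = e w b" "q w a = e w a" "q b w = e w a" "q w b = e w b"
    if "w \<notin> ?S" for w
    using D(4)[of a w] D(5)[of a w] D(4)[of b w] D(5)[of b w] D(6)[OF that] that p by auto
  define q1 where "q1 = mutate_quiver a q"
  define q2 where "q2 = mutate_quiver b q1"
  have q1_acyc: "two_acyclic q1"
    by (simp add: q1_def two_acyclic_mutate_quiver)
  have q1_a: "q1 a w = q w a" "q1 w a = q a w" for w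
    by (simp_all add: q1_def mutate_quiver_at[OF D(1)])
  \<comment> \<open>Without arrows between \<open>a\<close> and \<open>b\<close>, the mutation at
    \<open>a\<close> does not affect the arrows at \<open>b\<close>.\<close>
  have q1_b: "q1 b w = q b w" "q1 w b = q w b" for w
  proof -
    show "q1 b w = q b w"
      using two_acyclicD[OF D(1), of b w] q_ab
      by (cases "w = a") (auto simp: q1_a, auto simp: q1_def mutate_quiver_off[OF ab[symmetric]])
    show "q1 w b = q w b"
      using two_acyclicD[OF D(1), of b w] q_ab
      by (cases "w = a")
        (auto simp: q1_a, auto simp: q1_def mutate_quiver_off[OF _ ab[symmetric]])
  qed
  have q2_b: "q2 b w = q w b" "q2 w b = q b w" for w
    by (simp_all add: q2_def mutate_quiver_at[OF q1_acyc] q1_b)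
  have q2_a: "q2 a w = q w a" "q2 w a = q a w" for w
  proof -
    show "q2 a w = q w a"
      using two_acyclicD[OF D(1), of a w] q_ab
      by (cases "w = b") (auto simp: q2_b, auto simp: q2_def mutate_quiver_off[OF ab] q1_a q1_b)
    show "q2 w a = q a w"
      using two_acyclicD[OF D(1), of a w] q_ab
      by (cases "w = b")
        (auto simp: q2_b, auto simp: q2_def mutate_quiver_off[OF _ ab] q1_a q1_b)
  qed
  \<comment> \<open>Paths from \<open>i\<close> to \<open>j\<close> through \<open>a\<close> are as
    many as paths from \<open>j\<close> to \<open>i\<close> through \<open>b\<close>, so the two
    mutations compensate each other away from \<open>a\<close> and \<open>b\<close>.\<close>
  have q2_out: "q2 i j = q i j" if "i \<notin> ?S" "j \<notin> ?S" for i j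
    using that truncated_diff_twice[OF two_acyclicD[OF D(1), of i j]]
    by (simp add: q2_def mutate_quiver_off q1_b, simp add: q1_def mutate_quiver_off q_out
        mult.commute)
  have quiver: "q2 (transpose a b i) (transpose a b j) = q i j" for i j
  proof -
    consider "i \<in> ?S" | "j \<in> ?S" "i \<notin> ?S" | "i \<notin> ?S" "j \<notin> ?S"
      by blast
    then show ?thesis
    proof cases
      case 1
      then show ?thesis
        using q_ab q_loop q_out[of j] by (cases "j \<in> ?S") (auto simp: q2_a q2_b)
    next
      case 2
      then show ?thesis
        using q_out[of i] by (auto simp: q2_a q2_b)
    next
      case 3
      then show ?thesis
        using q2_out by simp
    qed
  qed
  define A where "A = (\<Prod>w\<in>V - ?S. x w ^ e w a)"
  define B where "B = (\<Prod>w\<in>V - ?S. x w ^ e w b)"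
  have prod_V: "(\<Prod>w\<in>V. y w ^ f w) = (\<Prod>w\<in>V - ?S. x w ^ g w)"
    if "f a = 0" "f b = 0" "\<And>w. w \<notin> ?S \<Longrightarrow> f w = g w" "\<And>w. w \<notin> ?S \<Longrightarrow> y w = x w"
    for y :: "_ \<Rightarrow> 'a" and f g :: "_ \<Rightarrow> nat"
  proof -
    have "(\<Prod>w\<in>V. y w ^ f w) = (\<Prod>w\<in>V - ?S. y w ^ f w) * (\<Prod>w\<in>?S. y w ^ f w)"
      using prod.subset_diff[OF V(2,1)] .
    also have "(\<Prod>w\<in>V - ?S. y w ^ f w) = (\<Prod>w\<in>V - ?S. x w ^ g w)"
      using that by (intro prod.cong) auto
    finally show ?thesis
      using that ab by simp
  qed
  define x1 where "x1 = mutate_vars V a q x"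
  have x1: "x1 = x(a := (A + B) / x a)"
    unfolding x1_def mutate_vars_def A_def B_def
    using prod_V[of "\<lambda>w. q a w" "\<lambda>w. e w b" x] prod_V[of "\<lambda>w. q w a" "\<lambda>w. e w a" x]
    by (simp add: q_ab q_loop q_out add.commute)
  \<comment> \<open>The changed variable at \<open>a\<close> does not enter this exchange; the
    numerator is again \<open>A + B\<close>.\<close>
  have x2: "mutate_vars V b q1 x1 = x1(b := (A + B) / x b)"
    unfolding mutate_vars_def A_def B_def
    using prod_V[of "\<lambda>w. q1 b w" "\<lambda>w. e w a" x1] prod_V[of "\<lambda>w. q1 w b" "\<lambda>w. e w b" x1] ab
    by (simp add: q_ab q_loop q1_b q_out x1)
  have nz: "x a \<noteq> 0" "x b \<noteq> 0"
    using x V zero_notin_Pos by (metis insert_subset)+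
  have pot: "potential V ?S s e x = (A + B) / (x a * x b)"
    unfolding potential_def A_def B_def using ab s by (simp add: field_simps add_divide_distrib)
  have "tau V [a, b] (q, x) = swap_vertices a b (q2, mutate_vars V b q1 x1)"
    by (simp add: tau_def mutate_def q2_def q1_def x1_def)
  also have "\<dots> = (q, scale ?S (potential V ?S s e x) x)"
    unfolding swap_vertices_def x2 unfolding x1 using quiver ab nz
    by (auto simp: pot scale_def fun_eq_iff transpose_def)
  finally show ?thesis .
qed

text \<open>Induction on \<open>vs\<close>, peeling off the first mutation. The inner sequence
  multiplies the remaining cycle variables by the common potential \<open>R\<close>. Each exchange
  monomial at \<open>v\<close> is linear in one of them, so mutating back at \<open>v\<close>
  produces \<open>R * x v\<close>.\<close>

theorem tau_cycle:
  assumes "cycle_in_quiver q (set vs) s p e" and "distinct vs" and "2 \<le> length vs"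
    and "finite V" and "set vs \<subseteq> V" and "\<And>w. w \<in> V \<Longrightarrow> x w \<in> Pos"
  shows "tau V vs (q, x) = (q, scale (set vs) (potential V (set vs) s e x) x)"
  using assms
proof (induction vs arbitrary: q s p e x)
  case Nil
  then show ?case
    by simp
next
  case (Cons v us)
  note cyc = Cons.prems(1)
  note D = cycle_in_quiverD[OF cyc]
  note cD = cyclic_orderD[OF D(2)]
  show ?case
  proof (cases "length us = 1")
    case True
    then obtain u where u: "us = [u]"
      by (auto simp: length_Suc_conv)
    then have S: "set (v # us) = {v, u}"
      by simp
    show ?thesis
      using tau_two_cycle[of q v u s p e V x] Cons.prems unfolding S u by auto
  next
    case False
    let ?S = "set (v # us)" and ?s = "s(p v := s v)" and ?p = "p(s v := p v)"
      and ?e = "reduced_cover p v e"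
    define R where "R = potential V ?S s e x"
    define x1 where "x1 = mutate_vars V v q x"
    define x2 where "x2 = scale (set us) R x1"
    have len: "2 \<le> length us"
      using False Cons.prems(3) by simp
    have v: "v \<in> ?S" and us: "?S - {v} = set us" and v_us: "v \<notin> set us"
      using Cons.prems(2) by auto
    have card: "3 \<le> card ?S"
      using len Cons.prems(2) distinct_card[of "v # us"] by simp
    have vV: "v \<in> V"
      using Cons.prems(5) by simp
    have x1_Pos: "x1 w \<in> Pos" if "w \<in> V" for w
      unfolding x1_def using Cons.prems(6) vV that by (rule mutate_vars_Pos)
    have nz: "x w \<noteq> 0" "x1 w \<noteq> 0" if "w \<in> V" for w
      using that Cons.prems(6) x1_Pos zero_notin_Pos by metis+
    have R_eq: "R = potential V (set us) ?s ?e x1"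
      unfolding R_def x1_def us[symmetric]
      using nz(1) Cons.prems(5)
      by (intro potential_mutate[OF cyc v card Cons.prems(4,5), symmetric]) blast
    have "tau V us (mutate_quiver v q, x1) = (mutate_quiver v q, x2)"
      unfolding x2_def R_eq
    proof (rule Cons.IH)
      show "cycle_in_quiver (mutate_quiver v q) (set us) ?s ?p ?e"
        using cycle_in_quiver_mutate[OF cyc v card] unfolding us .
    qed (use Cons.prems len x1_Pos in simp_all)
    moreover have "mutate_vars V v (mutate_quiver v q) x2 = scale ?S R x"
    proof -
      let ?X = "\<lambda>x. x (s v) * (\<Prod>w\<in>V - ?S. x w ^ (e w (p v) - e w v)) +
        x (p v) * (\<Prod>w\<in>V - ?S. x w ^ (e w v - e w (p v)))"
      have X: "(\<Prod>j\<in>V. y j ^ q v j) + (\<Prod>j\<in>V. y j ^ q j v) = ?X y" for y :: "_ \<Rightarrow> 'a"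
        by (simp add: prod_quiver_cycle[OF cyc v card Cons.prems(4,5)])
      have nbrs: "s v \<in> set us" "p v \<in> set us"
      proof -
        have "s v \<noteq> v"
          using cyclic_order_succ_neq[OF D(2) v] card by simp
        moreover from this have "p v \<noteq> v"
          using cD(4)[OF v] by metis
        ultimately show "s v \<in> set us" "p v \<in> set us"
          using us cD(1,2)[OF v] by blast+
      qed
      have x2_nbrs: "x2 (s v) = R * x (s v)" "x2 (p v) = R * x (p v)" "x2 v = x1 v"
        using nbrs v_us by (auto simp: x2_def scale_def x1_def mutate_vars_def)
      have x2_out: "x2 w = x w" if "w \<in> V - ?S" for w
        using that by (auto simp: x2_def scale_def x1_def mutate_vars_def)
      have "(\<Prod>w\<in>V - ?S. x2 w ^ f w) = (\<Prod>w\<in>V - ?S. x w ^ f w)" for f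
        using x2_out by (intro prod.cong) simp_all
      then have "?X x2 = R * ?X x"
        by (simp only: x2_nbrs distrib_left mult.assoc)
      moreover have "x1 v = ?X x / x v"
        by (simp only: x1_def mutate_vars_def fun_upd_same X)
      ultimately have "?X x2 / x2 v = R * x v"
        using nz[OF vV] x2_nbrs by (auto simp: field_simps)
      moreover have "x2 w = scale ?S R x w" if "w \<noteq> v" for w
        using that by (simp add: x2_def scale_def x1_def mutate_vars_def)
      \<comment> \<open>The reversed arrows exchange the two monomials, which leaves their sum
        unchanged.\<close>
      moreover have "mutate_quiver v q v j = q j v" "mutate_quiver v q j v = q v j" for j
        by (simp_all add: mutate_quiver_at[OF D(1)])
      ultimately show ?thesis
        using X[of x2] by (auto simp: mutate_vars_def fun_eq_iff scale_def add.commute)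
    qed
    ultimately show ?thesis
      unfolding tau_Cons[OF len] R_def[symmetric] x1_def
      by (simp add: mutate_def mutate_quiver_involution[OF D(1)])
  qed
qed

end

section \<open>Response of potentials to rescaling a circle\<close>

lemma potential_scale_self:
  fixes x :: "'v \<Rightarrow> 'a::field"
  assumes "\<And>c. c \<in> S \<Longrightarrow> s c \<in> S"
  shows "potential V S s e (scale S r x) = potential V S s e x / (r * r)"
proof -
  have "(\<Prod>w\<in>V - S. scale S r x w ^ e w c) = (\<Prod>w\<in>V - S. x w ^ e w c)" for c
    by (intro prod.cong) (auto simp: scale_def)
  then show ?thesis
    unfolding potential_def sum_divide_distrib
    using assms by (intro sum.cong) (auto simp: scale_def field_simps)
qed

text \<open>By the cover hypothesis every numerator has total degree one in the variables on
  \<open>T\<close>, while the denominators involve only \<open>S\<close>.\<close>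

lemma potential_scale_neighbour:
  fixes x :: "'v \<Rightarrow> 'a::field"
  assumes S: "\<And>c. c \<in> S \<Longrightarrow> s c \<in> S" and V: "finite V"
    and T: "T \<subseteq> V" "T \<inter> S = {}" and cover: "\<And>c. c \<in> S \<Longrightarrow> (\<Sum>w\<in>T. e w c) = 1"
  shows "potential V S s e (scale T r x) = r * potential V S s e x"
proof -
  have "(\<Prod>w\<in>V - S. scale T r x w ^ e w c) = r * (\<Prod>w\<in>V - S. x w ^ e w c)" if "c \<in> S" for c
  proof -
    have "(\<Prod>w\<in>V - S. scale T r x w ^ e w c) =
        (\<Prod>w\<in>V - S. (if w \<in> T then r ^ e w c else 1) * x w ^ e w c)"
      by (intro prod.cong) (auto simp: scale_def power_mult_distrib)
    also have "\<dots> = (\<Prod>w\<in>V - S. if w \<in> T then r ^ e w c else 1) * (\<Prod>w\<in>V - S. x w ^ e w c)"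
      by (rule prod.distrib)
    also have "(\<Prod>w\<in>V - S. if w \<in> T then r ^ e w c else 1) = (\<Prod>w\<in>T. r ^ e w c)"
      using V T by (intro prod.mono_neutral_cong_right) auto
    also have "\<dots> = r"
      using cover[OF that] by (simp flip: power_sum)
    finally show ?thesis .
  qed
  then show ?thesis
    unfolding potential_def sum_distrib_left
    using S T(2) by (intro sum.cong) (auto simp: scale_def)
qed

theorem (in positive_cone) tau_braid:
  assumes C: "cycle_in_quiver q (set cs) s p e" "distinct cs" "2 \<le> length cs" "set cs \<subseteq> V"
    and D: "cycle_in_quiver q (set ds) s' p' e'" "distinct ds" "2 \<le> length ds" "set ds \<subseteq> V"
    and disjoint: "set cs \<inter> set ds = {}"
    and cover_C: "\<And>c. c \<in> set cs \<Longrightarrow> (\<Sum>w\<in>set ds. e w c) = 1"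
    and cover_D: "\<And>d. d \<in> set ds \<Longrightarrow> (\<Sum>w\<in>set cs. e' w d) = 1"
    and V: "finite V" and x: "\<And>w. w \<in> V \<Longrightarrow> x w \<in> Pos"
  shows "tau V cs (tau V ds (tau V cs (q, x))) = tau V ds (tau V cs (tau V ds (q, x)))"
proof -
  let ?P = "potential V (set cs) s e" and ?Q = "potential V (set ds) s' e'"
  have s: "s c \<in> set cs" if "c \<in> set cs" for c
    using cyclic_orderD(1)[OF cycle_in_quiverD(2)[OF C(1)] that] .
  have s': "s' c \<in> set ds" if "c \<in> set ds" for c
    using cyclic_orderD(1)[OF cycle_in_quiverD(2)[OF D(1)] that] .
  have tau: "tau V cs (q, y) = (q, scale (set cs) (?P y) y)"
    "tau V ds (q, y) = (q, scale (set ds) (?Q y) y)" if "\<And>w. w \<in> V \<Longrightarrow> y w \<in> Pos" for y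
    using tau_cycle[OF C(1-3) V C(4) that] tau_cycle[OF D(1-3) V D(4) that] by auto
  have P_Pos: "?P y \<in> Pos" and Q_Pos: "?Q y \<in> Pos" if "\<And>w. w \<in> V \<Longrightarrow> y w \<in> Pos" for y
    using that C(3,4) D(3,4) s s' by (intro potential_Pos; force)+
  define P Q where "P = ?P x" and "Q = ?Q x"
  have P_Q: "P \<in> Pos" "Q \<in> Pos" "P * Q \<in> Pos"
    unfolding P_def Q_def by (simp_all add: P_Pos Q_Pos mult_Pos x)
  then have nz: "P \<noteq> 0" "Q \<noteq> 0"
    using zero_notin_Pos by metis+
  have disjoint': "set ds \<inter> set cs = {}"
    using disjoint by auto
  note scales = potential_scale_self[of "set cs" s, OF s]
    potential_scale_self[of "set ds" s', OF s']
    potential_scale_neighbour[OF s V D(4) disjoint' cover_C]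
    potential_scale_neighbour[OF s' V C(4) disjoint cover_D]
  \<comment> \<open>The first step turns the potentials into \<open>1 / P\<close> and
    \<open>P * Q\<close>. Scaling \<open>ds\<close> by \<open>P * Q\<close> then makes the potential
    of \<open>cs\<close> equal to \<open>Q\<close>.\<close>
  have "tau V cs (tau V ds (tau V cs (q, x))) =
      (q, scale (set cs) Q (scale (set ds) (P * Q) (scale (set cs) P x)))"
  proof -
    define y where "y = scale (set cs) P x"
    define z where "z = scale (set ds) (P * Q) y"
    have y: "y w \<in> Pos" if "w \<in> V" for w
      unfolding y_def using scale_Pos[OF x P_Q(1) that] .
    have z: "z w \<in> Pos" if "w \<in> V" for w
      unfolding z_def using scale_Pos[OF y P_Q(3) that] .
    have "?Q y = P * Q" "?P z = Q"
      using nz by (simp_all add: y_def z_def scales flip: P_def Q_def)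
    then show ?thesis
      by (simp add: tau(1)[OF x] tau(2)[OF y] tau(1)[OF z] flip: P_def y_def z_def)
  qed
  moreover have "tau V ds (tau V cs (tau V ds (q, x))) =
      (q, scale (set ds) P (scale (set cs) (P * Q) (scale (set ds) Q x)))"
  proof -
    define y where "y = scale (set ds) Q x"
    define z where "z = scale (set cs) (P * Q) y"
    have y: "y w \<in> Pos" if "w \<in> V" for w
      unfolding y_def using scale_Pos[OF x P_Q(2) that] .
    have z: "z w \<in> Pos" if "w \<in> V" for w
      unfolding z_def using scale_Pos[OF y P_Q(3) that] .
    have "?P y = P * Q" "?Q z = P"
      using nz by (simp_all add: y_def z_def scales flip: P_def Q_def)
    then show ?thesis
      by (simp add: tau(2)[OF x] tau(1)[OF y] tau(2)[OF z] flip: Q_def y_def z_def)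
  qed
  moreover have "scale (set cs) Q (scale (set ds) (P * Q) (scale (set cs) P x)) =
      scale (set ds) P (scale (set cs) (P * Q) (scale (set ds) Q x))"
    using disjoint by (auto simp: scale_def fun_eq_iff)
  ultimately show ?thesis
    by simp
qed

section \<open>Zigzags of arrows in an annulus\<close>

text \<open>Arrow \<open>k\<close> joins the vertex \<open>A k\<close> of one boundary circle to position \<open>r k\<close> on the other, which
  has \<open>m\<close> vertices; it points towards the latter if \<open>t k\<close>. A face after an arrow with \<open>t k\<close> has the
  apex \<open>A k\<close> and the path from \<open>r k\<close> to \<open>r (Suc k)\<close>; the other faces have their apex on the circle
  of the positions.\<close>

locale zigzag =
  fixes M m :: nat and A :: "nat \<Rightarrow> 'w" and r :: "nat \<Rightarrow> nat" and t :: "nat \<Rightarrow> bool"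
  assumes m_pos: "0 < m"
    and closed: "A M = A 0" "r M = r 0 + m" "t M = t 0"
    and up: "\<And>k. k < M \<Longrightarrow> t k \<Longrightarrow> \<not> t (Suc k) \<and> A (Suc k) = A k \<and> r k < r (Suc k)"
    and down: "\<And>k. k < M \<Longrightarrow> \<not> t k \<Longrightarrow> t (Suc k) \<and> A (Suc k) \<noteq> A k \<and> r (Suc k) = r k"

text \<open>Counts the faces with apex \<open>w\<close> whose arc contains the edge leaving
  \<open>d\<close>, with unrolled positions reduced modulo \<open>m\<close>. Faces with apex on the
  other circle have an empty arc and add nothing.\<close>

definition annulus_cover ::
    "nat \<Rightarrow> nat \<Rightarrow> (nat \<Rightarrow> 'w) \<Rightarrow> (nat \<Rightarrow> nat) \<Rightarrow> 'w \<Rightarrow> nat \<Rightarrow> nat" where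
  "annulus_cover M m A r w d =
     (\<Sum>k<M. of_bool (A k = w) * (\<Sum>i = r k..<r (Suc k). of_bool (i mod m = d)))"

context zigzag
begin

abbreviation "cover \<equiv> annulus_cover M m A r"

lemma r_mono: "k < M \<Longrightarrow> r k \<le> r (Suc k)"
  using up[of k] down[of k] by (cases "t k") auto

lemma M_pos: "0 < M"
  using closed(2) m_pos by (cases M) auto

text \<open>Shifting the window by one trades its lower end for its upper end, so an arc contributes
  only at its two endpoints.\<close>

lemma residue_telescope:
  assumes "l \<le> u"
  shows "(\<Sum>i = l..<u. of_bool (i mod m = d)) + (of_bool (u mod m = d) :: nat) =
    of_bool (l mod m = d) + (\<Sum>i = l..<u. of_bool (Suc i mod m = d))"
  using assms by (induction u rule: dec_induct) auto

lemma Suc_mod_eq_iff: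
  assumes "d < m"
  shows "Suc i mod m = d \<longleftrightarrow> i mod m = (d + m - 1) mod m"
proof -
  have "(d + m - 1) mod m = (if d = 0 then m - 1 else d - 1)"
  proof (cases d)
    case (Suc c)
    then have "d + m - 1 = c + m"
      by simp
    with Suc assms show ?thesis
      by simp
  qed (use m_pos in simp)
  then show ?thesis
    using assms m_pos mod_less_divisor[OF m_pos, of i] by (auto simp: mod_Suc)
qed

text \<open>The arc of a face with apex \<open>w\<close> begins where an arrow from \<open>w\<close>
  arrives and ends where an arrow to \<open>w\<close> departs. Hence the cover changes at
  \<open>d\<close> by arrows in minus arrows out. The additive form avoids truncation.\<close>

lemma cover_diff:
  assumes d: "d < m"
  shows "cover w d + card {k. k < M \<and> \<not> t k \<and> A k = w \<and> r k mod m = d} =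
    cover w ((d + m - 1) mod m) + card {k. k < M \<and> t k \<and> A k = w \<and> r k mod m = d}"
proof -
  define ins :: "nat \<Rightarrow> nat" where "ins k = of_bool (t k \<and> A k = w \<and> r k mod m = d)" for k
  define outs :: "nat \<Rightarrow> nat" where "outs k = of_bool (\<not> t k \<and> A k = w \<and> r k mod m = d)" for k
  have cards: "card {k. k < M \<and> \<not> t k \<and> A k = w \<and> r k mod m = d} = (\<Sum>k<M. outs k)"
    "card {k. k < M \<and> t k \<and> A k = w \<and> r k mod m = d} = (\<Sum>k<M. ins k)"
    by (auto simp: ins_def outs_def intro!: arg_cong[of _ _ card])
  \<comment> \<open>Adding \<open>outs k\<close> on both sides makes the identity valid also for the
    faces with an empty arc.\<close>
  have face: "of_bool (A k = w) * (\<Sum>i = r k..<r (Suc k). of_bool (i mod m = d)) +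
        (outs (Suc k) + outs k) =
      of_bool (A k = w) * (\<Sum>i = r k..<r (Suc k). of_bool (Suc i mod m = d)) + (ins k + outs k)"
    if "k < M" for k
    using residue_telescope[OF r_mono[OF that], of d] up[OF that] down[OF that]
    by (cases "t k"; cases "A k = w") (auto simp: ins_def outs_def)
  have "cover w d + ((\<Sum>k<M. outs (Suc k)) + (\<Sum>k<M. outs k)) =
      cover w ((d + m - 1) mod m) + ((\<Sum>k<M. ins k) + (\<Sum>k<M. outs k))"
    unfolding annulus_cover_def sum.distrib[symmetric] Suc_mod_eq_iff[OF d, symmetric]
    using face by (intro sum.cong) auto
  \<comment> \<open>Index \<open>M\<close> is arrow \<open>0\<close> seen again after a full
    turn.\<close>
  moreover have "(\<Sum>k<M. outs (Suc k)) = (\<Sum>k<M. outs k)"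
  proof -
    have "outs M = outs 0"
      using closed by (simp add: outs_def)
    then show ?thesis
      using sum.lessThan_Suc[of outs M] sum.lessThan_Suc_shift[of outs M] by simp
  qed
  ultimately show ?thesis
    unfolding cards by simp
qed

lemma sum_residue_period:
  assumes "d < m"
  shows "(\<Sum>i = l..<l + m. of_bool (i mod m = d)) = (1 :: nat)"
proof (induction l)
  case 0
  have "(\<Sum>i = 0..<m. of_bool (i mod m = d)) = (\<Sum>i = 0..<m. if i = d then 1 else 0 :: nat)"
    by (intro sum.cong) auto
  with assms show ?case
    by simp
next
  case (Suc l)
  define f :: "nat \<Rightarrow> nat" where "f i = of_bool (i mod m = d)" for i
  have "sum f {l..<Suc (l + m)} = sum f {l..<l + m} + f (l + m)"
    "sum f {l..<Suc (l + m)} = f l + sum f {Suc l..<Suc (l + m)}"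
    by (rule sum.atLeastLessThan_Suc; simp) (rule sum.atLeast_Suc_lessThan; simp)
  moreover have "f (l + m) = f l"
    by (simp add: f_def)
  ultimately show ?case
    using Suc by (simp only: f_def[abs_def] add_Suc)
qed

text \<open>The arcs of successive faces concatenate to one full turn, which passes each residue
  once.\<close>

lemma sum_cover:
  assumes d: "d < m" and U: "finite U" "\<And>k. k < M \<Longrightarrow> A k \<in> U"
  shows "(\<Sum>w\<in>U. cover w d) = 1"
proof -
  have "(\<Sum>w\<in>U. cover w d) =
      (\<Sum>k<M. \<Sum>w\<in>U. of_bool (A k = w) * (\<Sum>i = r k..<r (Suc k). of_bool (i mod m = d)))"
    unfolding annulus_cover_def by (rule sum.swap)
  also have "\<dots> = (\<Sum>k<M. \<Sum>i = r k..<r (Suc k). of_bool (i mod m = d))"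
  proof (intro sum.cong refl)
    fix k assume "k \<in> {..<M}"
    then show "(\<Sum>w\<in>U. of_bool (A k = w) * n) = n" for n :: nat
      using U sum.delta'[of U "A k" "\<lambda>_. n"]
      by (simp only: of_bool_def if_distribR mult_1 mult_zero_left if_distrib[of "\<lambda>i. i * n"]) simp
  qed
  also have "\<dots> = (\<Sum>i = r 0..<r M. of_bool (i mod m = d))"
  proof -
    have "(\<Sum>k<n. \<Sum>i = r k..<r (Suc k). of_bool (i mod m = d)) =
        (\<Sum>i = r 0..<r n. of_bool (i mod m = d) :: nat) \<and> r 0 \<le> r n" if "n \<le> M" for n
      using that
    proof (induction n)
      case (Suc n)
      then show ?case
        using r_mono[of n] by (auto simp: sum.atLeastLessThan_concat simp del: sum_of_bool_eq)
    qed simp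
    then show ?thesis
      by blast
  qed
  also have "\<dots> = 1"
    unfolding closed(2) by (rule sum_residue_period[OF d])
  finally show ?thesis .
qed

text \<open>The apex changes across each face with \<open>\<not> t k\<close>, and alternation
  together with closing up guarantees that such a face exists.\<close>

lemma ex_other_apex: "\<exists>k<M. t k \<and> A k \<noteq> w"
proof -
  have "\<exists>k<M. \<not> t k"
    using M_pos closed(3) up[of 0] by (cases "M = 1") (auto intro: exI[of _ 0] exI[of _ 1])
  then obtain k where k: "k < M" "\<not> t k"
    by blast
  show ?thesis
  proof (cases "A k = w")
    case True
    then have "t (Suc k)" "A (Suc k) \<noteq> w"
      using down[OF k] by auto
    then show ?thesis
      using k(1) closed M_pos
      by (cases "Suc k = M") (auto intro: exI[of _ 0] exI[of _ "Suc k"])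
  next
    case False
    \<comment> \<open>The cyclic predecessor of \<open>k\<close>, which is \<open>M - 1\<close> for
      \<open>k = 0\<close>; its face has the same apex as arrow \<open>k\<close>.\<close>
    obtain j where j: "j < M" "\<not> t (Suc j)" "A (Suc j) \<noteq> w"
    proof (cases k)
      case 0
      then show ?thesis
        using that[of "M - 1"] M_pos closed k False by simp
    next
      case (Suc j)
      then show ?thesis
        using that[of j] k False by simp
    qed
    then show ?thesis
      using up[of j] down[of j] by auto
  qed
qed

text \<open>The first edge in the arc of a face with another apex is covered by that apex, and its
  total cover is only one.\<close>

lemma ex_uncovered: "\<exists>d<m. cover w d = 0"
proof -
  obtain k where k: "k < M" "t k" "A k \<noteq> w"
    using ex_other_apex by blast
  let ?d = "r k mod m" and ?U = "insert w (A ` {..<M})"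
  have d: "?d < m"
    using m_pos by simp
  have "of_bool (r k mod m = ?d) \<le> (\<Sum>i = r k..<r (Suc k). of_bool (i mod m = ?d) :: nat)"
    using up[OF k(1,2)] by (intro member_le_sum) auto
  also have "\<dots> = of_bool (A k = A k) * (\<Sum>i = r k..<r (Suc k). of_bool (i mod m = ?d))"
    by simp
  also have "\<dots> \<le> cover (A k) ?d"
    unfolding annulus_cover_def using k(1)
    by (intro member_le_sum[of k "{..<M}"
          "\<lambda>j. of_bool (A j = A k) * (\<Sum>i = r j..<r (Suc j). of_bool (i mod m = ?d))"]) auto
  finally have "1 \<le> cover (A k) ?d"
    by simp
  moreover have "cover w ?d + cover (A k) ?d = (\<Sum>w\<in>{w, A k}. cover w ?d)"
    using k(3) by simp
  moreover have "\<dots> \<le> (\<Sum>w\<in>?U. cover w ?d)"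
    using k(1) by (intro sum_mono2) auto
  moreover have "(\<Sum>w\<in>?U. cover w ?d) = 1"
    using d by (intro sum_cover) auto
  ultimately have "cover w ?d = 0"
    by simp
  with d show ?thesis
    by blast
qed

end

section \<open>Spider webs\<close>

definition circle :: "web \<Rightarrow> nat \<Rightarrow> vertex set" where
  "circle W c = {c} \<times> {..<circle_size W c}"

definition circle_succ :: "web \<Rightarrow> vertex \<Rightarrow> vertex" where
  "circle_succ W v = position W (fst v) (Suc (snd v))"

definition circle_pred :: "web \<Rightarrow> vertex \<Rightarrow> vertex" where
  "circle_pred W v = position W (fst v) (snd v + circle_size W (fst v) - 1)"

lemma cyclic_order_circle:
  assumes "2 \<le> circle_size W c"
  shows "cyclic_order (circle W c) (circle_succ W) (circle_pred W)"
proof -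
  let ?m = "circle_size W c"
  have m: "0 < ?m"
    using assms by simp
  have "circle_succ W v \<in> circle W c \<and> circle_pred W v \<in> circle W c \<and>
      circle_pred W (circle_succ W v) = v \<and> circle_succ W (circle_pred W v) = v"
    if v: "v \<in> circle W c" for v
  proof -
    obtain i where i: "v = (c, i)" "i < ?m"
      using v by (auto simp: circle_def)
    have "Suc ((i + ?m - 1) mod ?m) mod ?m = (Suc (i + ?m - 1)) mod ?m"
      by (rule mod_Suc_eq)
    then have 1: "Suc ((i + ?m - 1) mod ?m) mod ?m = i"
      using i m by simp
    have 2: "(Suc i mod ?m + ?m - 1) mod ?m = i"
      using i m by (cases "Suc i = ?m") auto
    show ?thesis
      using 1 2 m by (simp add: circle_def circle_succ_def circle_pred_def position_def i(1))
  qed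
  moreover have "T = circle W c"
    if T: "T \<subseteq> circle W c" "T \<noteq> {}" "circle_succ W ` T \<subseteq> T" for T
  proof -
    obtain i where i: "(c, i) \<in> T" "i < ?m"
      using T(1,2) by (force simp: circle_def)
    have reach: "(c, (i + k) mod ?m) \<in> T" for k
    proof (induction k)
      case 0
      then show ?case
        using i by simp
    next
      case (Suc k)
      then have "circle_succ W (c, (i + k) mod ?m) \<in> T"
        using T(3) by blast
      then show ?case
        by (simp add: circle_succ_def position_def mod_Suc_eq)
    qed
    \<comment> \<open>Going from \<open>i\<close> to \<open>j\<close> takes
      \<open>j + ?m - i\<close> steps; adding \<open>?m\<close> prevents truncation.\<close>
    have "(c, j) \<in> T" if "j < ?m" for j
      using reach[of "j + ?m - i"] that i(2) by simp
    with T(1) show ?thesis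
      by (auto simp: circle_def)
  qed
  ultimately show ?thesis
    unfolding cyclic_order_def by blast
qed

text \<open>Consistent orientation makes all entries of \<open>face_sides\<close> equal. An inward
  arrow \<open>k\<close> gives the entry \<open>False\<close>, which excludes outer edges and makes
  arrow \<open>k + 1\<close> outward; the third side then lies on the inner circle. Outward arrows
  are dual.\<close>

lemma spider_web_annulus:
  assumes W: "spider_web W" and c: "Suc c < num_circles W"
  shows "0 < circle_size W c" and "0 < circle_size W (Suc c)"
    and "planar_annulus W c"
    and "\<And>k. k < num_arrows W c \<Longrightarrow> inward W c k \<Longrightarrow>
      \<not> inward W c (Suc k) \<and> outer_end W c (Suc k) = outer_end W c k \<and>
      inner_end W c k < inner_end W c (Suc k) \<and>
      position W (Suc c) (inner_end W c (Suc k)) \<noteq> position W (Suc c) (inner_end W c k)"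
    and "\<And>k. k < num_arrows W c \<Longrightarrow> \<not> inward W c k \<Longrightarrow>
      inward W c (Suc k) \<and> inner_end W c (Suc k) = inner_end W c k \<and>
      outer_end W c k < outer_end W c (Suc k) \<and>
      position W c (outer_end W c (Suc k)) \<noteq> position W c (outer_end W c k)"
proof -
  have size: "2 \<le> circle_size W c" "2 \<le> circle_size W (Suc c)"
    using W c by (simp_all add: spider_web_def)
  then show "0 < circle_size W c" "0 < circle_size W (Suc c)"
    by simp_all
  show planar: "planar_annulus W c"
    using W c by (simp add: spider_web_def)
  fix k
  assume k: "k < num_arrows W c"
  let ?o = "outer_end W c" and ?i = "inner_end W c"
  have le: "?o k \<le> ?o (Suc k)" "?i k \<le> ?i (Suc k)"
    using planar k by (auto simp: planar_annulus_def)
  have face: "directed_cycle_face W c k" "3 \<le> length (face_sides W c k)"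
    using W c k by (auto simp: spider_web_def)
  have sides: "set (face_sides W c k) = (if ?o k < ?o (Suc k) then {True} else {}) \<union>
      {inward W c (Suc k)} \<union> (if ?i k < ?i (Suc k) then {False} else {}) \<union> {\<not> inward W c k}"
    by (auto simp: face_sides_def)
  have len: "?o k < ?o (Suc k) \<or> ?i k < ?i (Suc k)"
    using face(2) by (auto simp: face_sides_def)
  \<comment> \<open>Distinct face vertices keep the endpoints of a nontrivial arc apart, so the arc
    is not a whole turn.\<close>
  have arc: "position W d v \<noteq> position W d u"
    if "distinct (map (position W d) [u..<Suc v])" "u < v" for d u v
  proof -
    have "inj_on (position W d) {u..<Suc v}"
      using that(1) by (simp add: distinct_map del: upt_Suc)
    moreover have "u \<in> {u..<Suc v}" "v \<in> {u..<Suc v}"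
      using that(2) by auto
    ultimately show ?thesis
      using that(2) inj_on_eq_iff[of "position W d" "{u..<Suc v}" v u] by simp
  qed
  have "distinct (map (position W c) [?o k..<Suc (?o (Suc k))])"
    "distinct (map (position W (Suc c)) [?i k..<Suc (?i (Suc k))])"
    using face(1)
    by (simp_all add: directed_cycle_face_def face_vertices_def distinct_map del: upt_Suc)
  note arcs = arc[OF this(1)] arc[OF this(2)]
  show "\<not> inward W c (Suc k) \<and> ?o (Suc k) = ?o k \<and> ?i k < ?i (Suc k) \<and>
      position W (Suc c) (?i (Suc k)) \<noteq> position W (Suc c) (?i k)"
    if "inward W c k"
    using face(1) sides len le arcs that
    by (auto simp: directed_cycle_face_def split: if_splits)
  show "inward W c (Suc k) \<and> ?i (Suc k) = ?i k \<and> ?o k < ?o (Suc k) \<and>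
      position W c (?o (Suc k)) \<noteq> position W c (?o k)"
    if "\<not> inward W c k"
    using face(1) sides len le arcs that
    by (auto simp: directed_cycle_face_def split: if_splits)
qed

lemma zigzag_inner:
  assumes "spider_web W" and "Suc c < num_circles W"
  shows "zigzag (num_arrows W c) (circle_size W (Suc c))
    (\<lambda>k. position W c (outer_end W c k)) (inner_end W c) (inward W c)"
  using spider_web_annulus[OF assms]
  by unfold_locales (auto simp: planar_annulus_def position_def)

text \<open>The same annulus seen from its outer circle: the direction is negated because
  \<open>t\<close> marks arrows pointing towards the circle of the positions.\<close>

lemma zigzag_outer:
  assumes "spider_web W" and "Suc c < num_circles W"
  shows "zigzag (num_arrows W c) (circle_size W c)
    (\<lambda>k. position W (Suc c) (inner_end W c k)) (outer_end W c) (\<lambda>k. \<not> inward W c k)"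
  using spider_web_annulus[OF assms]
  by unfold_locales (auto simp: planar_annulus_def position_def)

text \<open>Selects the annulus between the circle of the apex \<open>w\<close> and that of the edge
  leaving \<open>d\<close>, with \<open>w\<close> on the outer or on the inner side. The bound on
  \<open>fst w\<close> discards data beyond the innermost circle.\<close>

definition web_cover :: "web \<Rightarrow> vertex \<Rightarrow> vertex \<Rightarrow> nat" where
  "web_cover W w d =
     (if Suc (fst w) = fst d then
        annulus_cover (num_arrows W (fst w)) (circle_size W (fst d))
          (\<lambda>k. position W (fst w) (outer_end W (fst w) k)) (inner_end W (fst w)) w (snd d)
      else if fst w = Suc (fst d) \<and> fst w < num_circles W then
        annulus_cover (num_arrows W (fst d)) (circle_size W (fst d))
          (\<lambda>k. position W (fst w) (inner_end W (fst d) k)) (outer_end W (fst d)) w (snd d)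
      else 0)"

section \<open>Arrows between circles and their relation to covers\<close>

definition radial_arrows :: "web \<Rightarrow> vertex \<Rightarrow> vertex \<Rightarrow> (nat \<times> nat) set" where
  "radial_arrows W u v =
     {(c, k). Suc c < num_circles W \<and> k < num_arrows W c \<and> radial_arrow W c k = (u, v)}"

lemma fst_position [simp]: "fst (position W c p) = c"
  by (simp add: position_def)

lemma radial_arrow_eq:
  "radial_arrow W c k = (u, v) \<longleftrightarrow>
    (if inward W c k
     then position W c (outer_end W c k) = u \<and> position W (Suc c) (inner_end W c k) = v
     else position W (Suc c) (inner_end W c k) = u \<and> position W c (outer_end W c k) = v)"
  by (simp add: radial_arrow_def)

lemma card_radial_arrows_inward:
  assumes "Suc (fst u) = fst v" and "fst v < num_circles W"
  shows "card (radial_arrows W u v) = card {k. k < num_arrows W (fst u) \<and> inward W (fst u) k \<and>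
    position W (fst u) (outer_end W (fst u) k) = u \<and>
    position W (fst v) (inner_end W (fst u) k) = v}" (is "_ = card ?K")
proof -
  have "(c, k) \<in> radial_arrows W u v \<longleftrightarrow> c = fst u \<and> k \<in> ?K" for c k
  proof
    assume "(c, k) \<in> radial_arrows W u v"
    then have k: "k < num_arrows W c" and arrow: "radial_arrow W c k = (u, v)"
      by (auto simp: radial_arrows_def)
    have c: "c = fst u" and dir: "inward W c k"
      using arrow assms(1) by (auto simp: radial_arrow_eq split: if_splits)
    have "position W c (outer_end W c k) = u" "position W (Suc c) (inner_end W c k) = v"
      using arrow dir by (simp_all add: radial_arrow_eq)
    then show "c = fst u \<and> k \<in> ?K"
      using k c dir assms(1) by (metis (mono_tags, lifting) mem_Collect_eq)
  next
    assume "c = fst u \<and> k \<in> ?K"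
    then show "(c, k) \<in> radial_arrows W u v"
      using assms by (simp add: radial_arrows_def radial_arrow_eq)
  qed
  then have "radial_arrows W u v = Pair (fst u) ` ?K"
    by auto
  then show ?thesis
    by (simp add: card_image inj_on_def)
qed

lemma card_radial_arrows_outward:
  assumes "fst u = Suc (fst v)" and "fst u < num_circles W"
  shows "card (radial_arrows W u v) = card {k. k < num_arrows W (fst v) \<and> \<not> inward W (fst v) k \<and>
    position W (fst u) (inner_end W (fst v) k) = u \<and>
    position W (fst v) (outer_end W (fst v) k) = v}" (is "_ = card ?K")
proof -
  have "(c, k) \<in> radial_arrows W u v \<longleftrightarrow> c = fst v \<and> k \<in> ?K" for c k
  proof
    assume "(c, k) \<in> radial_arrows W u v"
    then have k: "k < num_arrows W c" and arrow: "radial_arrow W c k = (u, v)"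
      by (auto simp: radial_arrows_def)
    have c: "c = fst v" and dir: "\<not> inward W c k"
      using arrow assms(1) by (auto simp: radial_arrow_eq split: if_splits)
    have "position W (Suc c) (inner_end W c k) = u" "position W c (outer_end W c k) = v"
      using arrow dir by (simp_all add: radial_arrow_eq)
    then show "c = fst v \<and> k \<in> ?K"
      using k c dir assms(1) by (metis (mono_tags, lifting) mem_Collect_eq)
  next
    assume "c = fst v \<and> k \<in> ?K"
    then show "(c, k) \<in> radial_arrows W u v"
      using assms by (simp add: radial_arrows_def radial_arrow_eq)
  qed
  then have "radial_arrows W u v = Pair (fst v) ` ?K"
    by auto
  then show ?thesis
    by (simp add: card_image inj_on_def)
qed

lemma radial_arrows_empty:
  assumes "\<not> (Suc (fst u) = fst v \<and> fst v < num_circles W)"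
    and "\<not> (fst u = Suc (fst v) \<and> fst u < num_circles W)"
  shows "radial_arrows W u v = {}"
  using assms by (auto simp: radial_arrows_def radial_arrow_def Let_def split: if_splits)

lemma web_quiver_radial:
  "web_quiver W = cancel_2cycles (\<lambda>u v. of_bool (circle_arrow W u v) + card (radial_arrows W u v))"
  by (simp add: web_quiver_def radial_arrows_def)

lemma web_cover_diff:
  assumes W: "spider_web W" and c: "c < num_circles W" and d: "d \<in> circle W c"
    and w: "w \<notin> circle W c"
  shows "web_cover W w d + card (radial_arrows W d w) =
    web_cover W w (circle_pred W d) + card (radial_arrows W w d)"
proof -
  obtain i where i: "d = (c, i)" "i < circle_size W c"
    using d by (auto simp: circle_def)
  have pos: "position W c n = (c, i) \<longleftrightarrow> n mod circle_size W c = i" for n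
    by (auto simp: position_def)
  have pred: "circle_pred W (c, i) = (c, (i + circle_size W c - 1) mod circle_size W c)"
    by (simp add: circle_pred_def position_def)
  consider "Suc (fst w) = c" | "fst w = Suc c" "Suc c < num_circles W"
    | "Suc (fst w) \<noteq> c" "\<not> (fst w = Suc c \<and> Suc c < num_circles W)"
    by blast
  then show ?thesis
  proof cases
    case 1
    then interpret zigzag "num_arrows W (fst w)" "circle_size W c"
      "\<lambda>k. position W (fst w) (outer_end W (fst w) k)" "inner_end W (fst w)" "inward W (fst w)"
      using zigzag_inner[OF W, of "fst w"] c by simp
    show ?thesis
      using cover_diff[OF i(2), of w] 1 c
      by (simp add: card_radial_arrows_inward card_radial_arrows_outward web_cover_def pred
          pos i(1) conj_ac)
  next
    case 2
    then interpret zigzag "num_arrows W c" "circle_size W c"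
      "\<lambda>k. position W (fst w) (inner_end W c k)" "outer_end W c" "\<lambda>k. \<not> inward W c k"
      using zigzag_outer[OF W, of c] by simp
    show ?thesis
      using cover_diff[OF i(2), of w] 2
      by (simp add: card_radial_arrows_inward card_radial_arrows_outward web_cover_def pred
          pos i(1) conj_ac)
  next
    case 3
    then show ?thesis
      using c by (auto simp: radial_arrows_empty web_cover_def pred i(1))
  qed
qed

lemma ex_web_uncovered:
  assumes W: "spider_web W" and c: "c < num_circles W"
  shows "\<exists>d\<in>circle W c. web_cover W w d = 0"
proof -
  have "0 < circle_size W c"
    using W c by (auto simp: spider_web_def)
  consider "Suc (fst w) = c" | "fst w = Suc c" "Suc c < num_circles W"
    | "Suc (fst w) \<noteq> c" "\<not> (fst w = Suc c \<and> Suc c < num_circles W)"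
    by blast
  then have "\<exists>i<circle_size W c. web_cover W w (c, i) = 0"
  proof cases
    case 1
    then interpret zigzag "num_arrows W (fst w)" "circle_size W c"
      "\<lambda>k. position W (fst w) (outer_end W (fst w) k)" "inner_end W (fst w)" "inward W (fst w)"
      using zigzag_inner[OF W, of "fst w"] c by simp
    show ?thesis
      using ex_uncovered[of w] 1 by (simp add: web_cover_def)
  next
    case 2
    then interpret zigzag "num_arrows W c" "circle_size W c"
      "\<lambda>k. position W (fst w) (inner_end W c k)" "outer_end W c" "\<lambda>k. \<not> inward W c k"
      using zigzag_outer[OF W, of c] by simp
    show ?thesis
      using ex_uncovered[of w] 2 by (simp add: web_cover_def)
  next
    case 3
    then show ?thesis
      using \<open>0 < circle_size W c\<close> by (auto simp: web_cover_def)
  qed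
  then show ?thesis
    by (auto simp: circle_def)
qed

lemma sum_web_cover_neighbour:
  assumes W: "spider_web W" and c: "c < num_circles W" "c' < num_circles W"
    and adj: "c' = Suc c \<or> c = Suc c'" and d: "d \<in> circle W c"
  shows "(\<Sum>w\<in>circle W c'. web_cover W w d) = 1"
proof -
  obtain i where i: "d = (c, i)" "i < circle_size W c"
    using d by (auto simp: circle_def)
  have fin: "finite (circle W c')"
    by (simp add: circle_def)
  have "0 < circle_size W c'"
    using W c by (auto simp: spider_web_def)
  then have pos: "position W c' n \<in> circle W c'" for n
    by (simp add: circle_def position_def)
  show ?thesis
  proof (cases "c' = Suc c")
    case True
    then interpret zigzag "num_arrows W c" "circle_size W c"
      "\<lambda>k. position W c' (inner_end W c k)" "outer_end W c" "\<lambda>k. \<not> inward W c k"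
      using zigzag_outer[OF W, of c] c by simp
    have "(\<Sum>w\<in>circle W c'. web_cover W w d) = (\<Sum>w\<in>circle W c'. cover w i)"
      using True c by (intro sum.cong) (auto simp: web_cover_def i(1) circle_def)
    then show ?thesis
      using sum_cover[OF i(2) fin pos] by simp
  next
    case False
    with adj have c': "Suc c' = c"
      by simp
    then interpret zigzag "num_arrows W c'" "circle_size W c"
      "\<lambda>k. position W c' (outer_end W c' k)" "inner_end W c'" "inward W c'"
      using zigzag_inner[OF W, of c'] c by simp
    have "(\<Sum>w\<in>circle W c'. web_cover W w d) = (\<Sum>w\<in>circle W c'. cover w i)"
      using c' by (intro sum.cong) (auto simp: web_cover_def i(1) circle_def)
    then show ?thesis
      using sum_cover[OF i(2) fin pos] by simp
  qed
qed

text \<open>Circle arrows stay on one circle and radial arrows always change it, so the two kinds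
  never mix. Cancelling in the additive identity for covers yields both truncated
  differences.\<close>

theorem circle_in_web_quiver:
  assumes W: "spider_web W" and c: "c < num_circles W"
  shows "cycle_in_quiver (web_quiver W) (circle W c) (circle_succ W) (circle_pred W) (web_cover W)"
proof -
  have size: "2 \<le> circle_size W c"
    using W c by (auto simp: spider_web_def)
  have arrow: "circle_arrow W u v \<longleftrightarrow> v = circle_succ W u" if "u \<in> circle W c" for u v
    using that c by (auto simp: circle_arrow_def circle_succ_def circle_def web_vertices_def)
  have inner: "web_quiver W u v = of_bool (v = circle_succ W u) - of_bool (u = circle_succ W v)"
    if "u \<in> circle W c" "v \<in> circle W c" for u v
  proof -
    have "fst u = fst v"
      using that by (auto simp: circle_def)
    then show ?thesis
      using that by (simp add: web_quiver_radial cancel_2cycles_def arrow radial_arrows_empty)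
  qed
  have outer: "web_quiver W u w = web_cover W w (circle_pred W u) - web_cover W w u \<and>
      web_quiver W w u = web_cover W w u - web_cover W w (circle_pred W u)"
    if u: "u \<in> circle W c" and w: "w \<notin> circle W c" for u w
  proof -
    have "\<not> circle_arrow W u w"
      using cyclic_orderD(1)[OF cyclic_order_circle[OF size] u] w by (auto simp: arrow[OF u])
    moreover have "\<not> circle_arrow W w u"
    proof
      assume "circle_arrow W w u"
      then have "fst u = fst w" "w \<in> web_vertices W"
        by (auto simp: circle_arrow_def)
      then show False
        using u w by (auto simp: web_vertices_def circle_def)
    qed
    ultimately show ?thesis
      using web_cover_diff[OF W c u w]
      by (simp add: web_quiver_radial cancel_2cycles_def) arith
  qed
  show ?thesis
    unfolding cycle_in_quiver_def
    using cyclic_order_circle[OF size] inner outer ex_web_uncovered[OF W c]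
    by (auto simp: two_acyclic_cancel_2cycles web_quiver_def)
qed

lemma circle_labelling_props:
  shows "set (circle_labelling W c a) = circle W c"
    and "distinct (circle_labelling W c a)"
    and "length (circle_labelling W c a) = circle_size W c"
  by (auto simp: circle_labelling_def circle_def distinct_map inj_on_def)

section \<open>Subtraction-free rational functions\<close>

definition nonneg_poly :: "((nat \<Rightarrow>\<^sub>0 nat) \<Rightarrow>\<^sub>0 rat) \<Rightarrow> bool" where
  "nonneg_poly f \<longleftrightarrow> (\<forall>k. 0 \<le> Poly_Mapping.lookup f k)"

lemma nonneg_poly_add: "nonneg_poly f \<Longrightarrow> nonneg_poly g \<Longrightarrow> nonneg_poly (f + g)"
  by (simp add: nonneg_poly_def lookup_add)

lemma Sum_any_nonneg:
  fixes f :: "'i \<Rightarrow> rat"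
  assumes "\<And>i. 0 \<le> f i"
  shows "0 \<le> Sum_any f"
  unfolding Sum_any.expand_set using assms by (rule sum_nonneg)

lemma nonneg_poly_mult: "nonneg_poly f \<Longrightarrow> nonneg_poly g \<Longrightarrow> nonneg_poly (f * g)"
  unfolding nonneg_poly_def lookup_mult
  by (intro allI Sum_any_nonneg mult_nonneg_nonneg) (auto intro!: Sum_any_nonneg simp: when_def)

text \<open>Nonnegative coefficients cannot cancel; this keeps numerators of sums nonzero.\<close>

lemma nonneg_poly_add_eq_0:
  assumes "nonneg_poly f" "nonneg_poly g" "f + g = 0"
  shows "f = 0"
proof (rule poly_mapping_eqI)
  fix k
  have "Poly_Mapping.lookup f k + Poly_Mapping.lookup g k = 0"
    using assms(3) by (simp flip: lookup_add)
  then show "Poly_Mapping.lookup f k = Poly_Mapping.lookup 0 k"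
    using assms(1,2) by (simp add: nonneg_poly_def add_nonneg_eq_0_iff)
qed

definition pos_ratfun :: "ratfun set" where
  "pos_ratfun = {Fract f g | f g. nonneg_poly f \<and> nonneg_poly g \<and> f \<noteq> 0 \<and> g \<noteq> 0}"

lemma pos_ratfunI: "nonneg_poly f \<Longrightarrow> nonneg_poly g \<Longrightarrow> f \<noteq> 0 \<Longrightarrow> g \<noteq> 0 \<Longrightarrow> Fract f g \<in> pos_ratfun"
  by (auto simp: pos_ratfun_def)

lemma nonneg_poly_single: "0 \<le> a \<Longrightarrow> nonneg_poly (Poly_Mapping.single k a)"
  by (simp add: nonneg_poly_def lookup_single when_def)

lemma nonneg_poly_one: "nonneg_poly 1"
  using nonneg_poly_single[of 1 0] by simp

interpretation ratfun: positive_cone pos_ratfun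
proof
  show "1 \<in> pos_ratfun"
    using pos_ratfunI[of 1 1] by (simp add: nonneg_poly_one flip: One_fract_def)
  show "0 \<notin> pos_ratfun"
    by (auto simp: pos_ratfun_def Zero_fract_def eq_fract)
next
  fix a b
  assume "a \<in> pos_ratfun" "b \<in> pos_ratfun"
  then obtain f g h k where ab: "a = Fract f g" "b = Fract h k"
    and nn: "nonneg_poly f" "nonneg_poly g" "nonneg_poly h" "nonneg_poly k"
    and nz: "f \<noteq> 0" "g \<noteq> 0" "h \<noteq> 0" "k \<noteq> 0"
    by (auto simp: pos_ratfun_def)
  have "f * k + h * g \<noteq> 0"
    using nonneg_poly_add_eq_0[of "f * k" "h * g"] nn nz by (auto simp: nonneg_poly_mult)
  then show "a + b \<in> pos_ratfun"
    using nn nz by (auto simp: ab intro!: pos_ratfunI nonneg_poly_add nonneg_poly_mult)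
  show "a * b \<in> pos_ratfun"
    using nn nz by (auto simp: ab intro!: pos_ratfunI nonneg_poly_mult)
next
  fix a
  assume "a \<in> pos_ratfun"
  then obtain f g where "a = Fract f g" "nonneg_poly f" "nonneg_poly g" "f \<noteq> 0" "g \<noteq> 0"
    by (auto simp: pos_ratfun_def)
  then show "inverse a \<in> pos_ratfun"
    by (simp add: pos_ratfunI)
qed

lemma indeterminate_pos: "indeterminate m \<in> pos_ratfun"
proof -
  have "Poly_Mapping.single k (1 :: rat) \<noteq> 0" for k :: "nat \<Rightarrow>\<^sub>0 nat"
    by (metis lookup_single_eq lookup_zero zero_neq_one)
  then show ?thesis
    unfolding indeterminate_def by (intro pos_ratfunI nonneg_poly_single nonneg_poly_one) simp_all
qed

section \<open>The braid relation for adjacent circles\<close>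

theorem theorem6p7:
  fixes W :: web and C D a b :: nat
    and \<tau>\<^sub>C \<tau>\<^sub>D :: "(vertex, ratfun) seed \<Rightarrow> (vertex, ratfun) seed"
  assumes "spider_web W"
    and "C < num_circles W" and "D < num_circles W"
    and "D = Suc C \<or> C = Suc D"
  defines "\<tau>\<^sub>C \<equiv> tau (web_vertices W) (circle_labelling W C a)"
    and "\<tau>\<^sub>D \<equiv> tau (web_vertices W) (circle_labelling W D b)"
  shows "\<forall>v \<in> web_vertices W.
           snd (\<tau>\<^sub>C (\<tau>\<^sub>D (\<tau>\<^sub>C (initial_seed W)))) v = snd (\<tau>\<^sub>D (\<tau>\<^sub>C (\<tau>\<^sub>D (initial_seed W)))) v"
proof -
  have size: "2 \<le> circle_size W c" if "c < num_circles W" for c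
    using assms(1) that by (simp add: spider_web_def)
  have subset: "circle W c \<subseteq> web_vertices W" if "c < num_circles W" for c
    using that by (auto simp: circle_def web_vertices_def)
  \<comment> \<open>The entire seeds agree, quivers included.\<close>
  have "\<tau>\<^sub>C (\<tau>\<^sub>D (\<tau>\<^sub>C (initial_seed W))) = \<tau>\<^sub>D (\<tau>\<^sub>C (\<tau>\<^sub>D (initial_seed W)))"
    unfolding \<tau>\<^sub>C_def \<tau>\<^sub>D_def initial_seed_def
  proof (rule ratfun.tau_braid, unfold circle_labelling_props)
    show "circle W C \<inter> circle W D = {}"
      using assms(4) by (auto simp: circle_def)
    show "(\<Sum>w\<in>circle W D. web_cover W w c) = 1" if "c \<in> circle W C" for c
      using sum_web_cover_neighbour[OF assms(1-3) _ that] assms(4) by blast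
    show "(\<Sum>w\<in>circle W C. web_cover W w d) = 1" if "d \<in> circle W D" for d
      using sum_web_cover_neighbour[OF assms(1,3,2) _ that] assms(4) by blast
    show "finite (web_vertices W)"
      by (simp add: web_vertices_def)
  qed (use assms(1-3) size subset circle_in_web_quiver indeterminate_pos
      in \<open>auto simp: circle_labelling_props\<close>)
  then show ?thesis
    by simp
qed

end
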